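(* Consider an instance $I$ of $R||C_{\max}$ with a value $\gamma>0$ such that $p_{i,j}\in[\gamma,3\gamma]\cup\{\infty\}$ for all machines $i$ and all jobs $j$. Then for this instance the configuration-LP has an integrality gap of at most $1+\frac{5}{6}$, i.e., $C^*(I)\le\left(1+\frac56\right)C_{\mathrm{conf}}(I)$, where $C^*(I)$ is the minimum makespan of $I$ and $C_{\mathrm{conf}}(I)$ is the smallest integer $T$ for which the configuration-LP of $I$ with target makespan $T$ is feasible.
   Context: $R||C_{\max}$: an instance consists of a finite nonempty set $J$ of jobs, a finite nonempty set $M$ of machines, and processing times $p_{i,j}\in\mathbb{N}^+\cup\{\infty\}$ for $i\in M$, $j\in J$, such that each job has finite processing time on at least one machine. A schedule assigns each job to one machine; the load of machine $i$ is the sum of $p_{i,j}$ over jobs $j$ assigned to $i$; the makespan is the maximum load. $C^*(I)$ is the minimum makespan over all assignments. Configuration-LP with target makespan $T$: for $i\in M$ let $\mathcal{C}_i(T)=\{C\subseteq J : \sum_{j\in C}p_{i,j}\le T\}$. The LP has variables $y_{i,C}\ge 0$ for $i\in M$, $C\in\mathcal{C}_i(T)$ and constraints $$\sum_{C\in\mathcal{C}_i(T)} y_{i,C}=1\ \text{ for all } i\in M,\qquad \sum_{i\in M}\ \sum_{C\in\mathcal{C}_i(T):\,C\ni j} y_{i,C}=1\ \text{ for all } j\in J.$$ *)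

theory Defs
  imports Complex_Main "HOL-Library.FuncSet" "HOL-Library.Extended_Nat" "HOL-Library.Extended_Real"
begin

locale unrelated_instance =
  fixes J :: "'j set" and M :: "'m set" and p :: "'m \<Rightarrow> 'j \<Rightarrow> enat"
  assumes finite_jobs: "finite J" and jobs_nonempty: "J \<noteq> {}"
    and finite_machines: "finite M" and machines_nonempty: "M \<noteq> {}"
    and processing_pos: "\<And>i j. i \<in> M \<Longrightarrow> j \<in> J \<Longrightarrow> 0 < p i j"
    and processing_finite: "\<And>j. j \<in> J \<Longrightarrow> \<exists>i\<in>M. p i j < \<infinity>"

text \<open>
  Schedules are the extensional functions from jobs to machines, so that there are only
  finitely many of them and the minimum below is attained. A job may be assigned to a machine
  on which its processing time is infinite; the makespan is then infinite.
\<close>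

definition schedules :: "'j set \<Rightarrow> 'm set \<Rightarrow> ('j \<Rightarrow> 'm) set" where
  "schedules J M = J \<rightarrow>\<^sub>E M"

definition machine_load :: "'j set \<Rightarrow> ('m \<Rightarrow> 'j \<Rightarrow> enat) \<Rightarrow> ('j \<Rightarrow> 'm) \<Rightarrow> 'm \<Rightarrow> enat" where
  "machine_load J p \<sigma> i = (\<Sum>j\<in>{j\<in>J. \<sigma> j = i}. p i j)"

definition makespan :: "'j set \<Rightarrow> 'm set \<Rightarrow> ('m \<Rightarrow> 'j \<Rightarrow> enat) \<Rightarrow> ('j \<Rightarrow> 'm) \<Rightarrow> enat" where
  "makespan J M p \<sigma> = Max (machine_load J p \<sigma> ` M)"

definition min_makespan :: "'j set \<Rightarrow> 'm set \<Rightarrow> ('m \<Rightarrow> 'j \<Rightarrow> enat) \<Rightarrow> enat" where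
  "min_makespan J M p = Min (makespan J M p ` schedules J M)"

definition configurations :: "'j set \<Rightarrow> ('m \<Rightarrow> 'j \<Rightarrow> enat) \<Rightarrow> nat \<Rightarrow> 'm \<Rightarrow> 'j set set" where
  "configurations J p T i = {C. C \<subseteq> J \<and> (\<Sum>j\<in>C. p i j) \<le> enat T}"

definition conf_LP_solution ::
    "'j set \<Rightarrow> 'm set \<Rightarrow> ('m \<Rightarrow> 'j \<Rightarrow> enat) \<Rightarrow> nat \<Rightarrow> ('m \<Rightarrow> 'j set \<Rightarrow> real) \<Rightarrow> bool" where
  "conf_LP_solution J M p T y \<longleftrightarrow>
     (\<forall>i\<in>M. \<forall>C\<in>configurations J p T i. 0 \<le> y i C) \<and>
     (\<forall>i\<in>M. (\<Sum>C\<in>configurations J p T i. y i C) = 1) \<and>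
     (\<forall>j\<in>J. (\<Sum>i\<in>M. \<Sum>C\<in>{C\<in>configurations J p T i. j \<in> C}. y i C) = 1)"

definition conf_LP_feasible ::
    "'j set \<Rightarrow> 'm set \<Rightarrow> ('m \<Rightarrow> 'j \<Rightarrow> enat) \<Rightarrow> nat \<Rightarrow> bool" where
  "conf_LP_feasible J M p T \<longleftrightarrow> (\<exists>y. conf_LP_solution J M p T y)"

text \<open>
  Natural-number targets suffice for the smallest feasible integer: for a negative target even
  the empty configuration is excluded, so the LP is infeasible.
\<close>

definition conf_LP_value :: "'j set \<Rightarrow> 'm set \<Rightarrow> ('m \<Rightarrow> 'j \<Rightarrow> enat) \<Rightarrow> nat" where
  "conf_LP_value J M p = (LEAST T. conf_LP_feasible J M p T)"

end

theory Submission
  imports Defs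
begin

text \<open>
  Let \<open>x i j\<close> be the fraction of job \<open>j\<close> that an LP solution with target \<open>T\<close> puts on machine \<open>i\<close>.
  As in the rounding of Shmoys and Tardos, every machine gets slots \<open>0, 1, 2, \<dots>\<close>; job \<open>j\<close> fits
  into slot \<open>k\<close> of \<open>i\<close> if \<open>x i j > 0\<close> and the jobs at least as long as \<open>j\<close> have total fraction
  more than \<open>k\<close> on \<open>i\<close>. By Hall's theorem all jobs can be matched to slots. A job in slot \<open>k\<close> has length at
  most \<open>T / (k + 1)\<close>, because some configuration contains \<open>k + 1\<close> jobs that are at least as long;
  and the jobs in the slots \<open>k \<ge> 1\<close> have total length at most \<open>T\<close>. If \<open>4 * \<gamma> > T\<close>, then only the slots
  \<open>0, 1, 2\<close> are used and the load is at most \<open>T + T / 2 + T / 3\<close>; otherwise it is at most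
  \<open>3 * \<gamma> + T \<le> 3 / 4 * T + T\<close>.
\<close>

section \<open>Hall's marriage theorem\<close>

text \<open>The induction of Halmos and Vaughan. If some nonempty proper subset is tight, it is
  matched first and the rest is matched outside its neighbourhood. Otherwise every such subset has a
  spare neighbour, so one element can be matched arbitrarily.\<close>

theorem hall_marriage:
  assumes "finite I"
    and "\<And>i. i \<in> I \<Longrightarrow> finite (A i)"
    and "\<And>S. S \<subseteq> I \<Longrightarrow> card S \<le> card (\<Union>(A ` S))"
  shows "\<exists>f. inj_on f I \<and> (\<forall>i\<in>I. f i \<in> A i)"
  using assms
proof (induction I arbitrary: A rule: finite_psubset_induct)
  case (psubset I)
  note fin = psubset.prems(1) and hall = psubset.prems(2)
  show ?case
  proof (cases "\<exists>S. S \<subset> I \<and> S \<noteq> {} \<and> card S = card (\<Union>(A ` S))")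
    case True
    then obtain S where S: "S \<subset> I" "S \<noteq> {}" "card S = card (\<Union>(A ` S))" by blast
    have finS: "finite S" using S(1) psubset.hyps by (meson finite_subset psubset_imp_subset)
    have "\<exists>f. inj_on f S \<and> (\<forall>i\<in>S. f i \<in> A i)"
      using S(1) fin hall by (intro psubset.IH) auto
    then obtain f where f: "inj_on f S" "\<And>i. i \<in> S \<Longrightarrow> f i \<in> A i" by blast
    have "\<exists>g. inj_on g (I - S) \<and> (\<forall>i\<in>I - S. g i \<in> A i - \<Union>(A ` S))"
    proof (intro psubset.IH)
      show "I - S \<subset> I" using S by blast
      show "finite (A i - \<Union>(A ` S))" if "i \<in> I - S" for i using fin that by auto
      fix R assume R: "R \<subseteq> I - S"
      have finR: "finite R" using R psubset.hyps by (meson finite_Diff finite_subset)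
      let ?U = "\<Union>i\<in>R. A i - \<Union>(A ` S)"
      have "finite (A i)" if "i \<in> R \<union> S" for i using fin R S(1) that by blast
      then have finU: "finite ?U" "finite (\<Union>(A ` S))" using finR finS by auto
      \<comment> \<open>Hall's condition for the reduced family: apply the original condition to
        \<open>R \<union> S\<close> and cancel \<open>card S\<close> against its equally large
        neighbourhood.\<close>
      have "card R + card S = card (R \<union> S)"
        using R finR finS by (intro card_Un_disjoint[symmetric]) auto
      also have "\<dots> \<le> card (\<Union>(A ` (R \<union> S)))"
        using R S(1) by (intro hall) auto
      also have "\<Union>(A ` (R \<union> S)) = ?U \<union> \<Union>(A ` S)" by auto
      also have "card \<dots> = card ?U + card (\<Union>(A ` S))"
        using finU by (intro card_Un_disjoint) auto
      finally show "card R \<le> card ?U" using S(3) by simp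
    qed
    then obtain g where g: "inj_on g (I - S)" "\<And>i. i \<in> I - S \<Longrightarrow> g i \<in> A i - \<Union>(A ` S)" by blast
    let ?h = "\<lambda>i. if i \<in> S then f i else g i"
    have "inj_on ?h I"
    proof (rule inj_onI)
      fix a b assume ab: "a \<in> I" "b \<in> I" "?h a = ?h b"
      then show "a = b"
        using f g(2)[of a] g(2)[of b] inj_onD[OF f(1), of a b] inj_onD[OF g(1), of a b]
        by (cases "a \<in> S"; cases "b \<in> S"; force)
    qed
    moreover have "\<forall>i\<in>I. ?h i \<in> A i" using f(2) g(2) by auto
    ultimately show ?thesis by blast
  next
    case tight: False
    show ?thesis
    proof (cases "I = {}")
      case False
      then obtain i where i: "i \<in> I" by blast
      have "A i \<noteq> {}" using hall[of "{i}"] i by auto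
      then obtain x where x: "x \<in> A i" by blast
      have "\<exists>g. inj_on g (I - {i}) \<and> (\<forall>j\<in>I - {i}. g j \<in> A j - {x})"
      proof (intro psubset.IH)
        show "I - {i} \<subset> I" using i by blast
        show "finite (A j - {x})" if "j \<in> I - {i}" for j using fin that by auto
        fix R assume R: "R \<subseteq> I - {i}"
        show "card R \<le> card (\<Union>j\<in>R. A j - {x})"
        proof (cases "R = {}")
          case False
          have "R \<subset> I" using R i by blast
          \<comment> \<open>Since \<open>R\<close> is not tight, the inequality is strict and pays
            for the removal of \<open>x\<close>.\<close>
          then have "card R < card (\<Union>(A ` R))"
            using tight hall[of R] False by (metis le_neq_implies_less psubset_imp_subset)
          moreover have "card (\<Union>(A ` R)) - 1 \<le> card (\<Union>(A ` R) - {x})"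
            by (metis Diff_empty Diff_insert0 card_Diff_singleton diff_le_self order_refl)
          ultimately have "card R \<le> card (\<Union>(A ` R) - {x})" by linarith
          also have "\<Union>(A ` R) - {x} = (\<Union>j\<in>R. A j - {x})" by auto
          finally show ?thesis .
        qed simp
      qed
      then obtain g where g: "inj_on g (I - {i})" "\<And>j. j \<in> I - {i} \<Longrightarrow> g j \<in> A j - {x}" by blast
      have "inj_on (g(i := x)) I"
        using g by (auto simp: inj_on_def)
      moreover have "\<forall>j\<in>I. (g(i := x)) j \<in> A j" using g(2) x by auto
      ultimately show ?thesis by blast
    qed simp
  qed
qed

section \<open>Fractional assignments and slots\<close>

text \<open>The threshold form treats jobs of equal length alike, so that ties are never broken, and
  it lets \<open>s\<close> serve as an integration variable later.\<close>

definition tail_weight :: "'j set \<Rightarrow> ('j \<Rightarrow> nat) \<Rightarrow> ('j \<Rightarrow> real) \<Rightarrow> nat \<Rightarrow> real" where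
  "tail_weight J q x s = (\<Sum>j\<in>{j\<in>J. s \<le> q j}. x j)"

text \<open>Hall's condition holds machine by machine: the slots that a set \<open>S\<close> of jobs
  can use on \<open>i\<close> are at least as many as the total fraction of \<open>S\<close> on
  \<open>i\<close>. Summed over all machines, these fractions give \<open>card S\<close>.\<close>

lemma slot_matching:
  fixes x :: "'m \<Rightarrow> 'j \<Rightarrow> real" and q :: "'m \<Rightarrow> 'j \<Rightarrow> nat"
  assumes "finite J" "finite M"
    and nonneg: "\<And>i j. i \<in> M \<Longrightarrow> j \<in> J \<Longrightarrow> 0 \<le> x i j"
    and total: "\<And>j. j \<in> J \<Longrightarrow> (\<Sum>i\<in>M. x i j) = 1"
  obtains \<sigma> \<kappa> where "inj_on (\<lambda>j. (\<sigma> j, \<kappa> j)) J"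
    and "\<And>j. j \<in> J \<Longrightarrow> \<sigma> j \<in> M" and "\<And>j. j \<in> J \<Longrightarrow> 0 < x (\<sigma> j) j"
    and "\<And>j. j \<in> J \<Longrightarrow> real (\<kappa> j) < tail_weight J (q (\<sigma> j)) (x (\<sigma> j)) (q (\<sigma> j) j)"
proof -
  define K where
    "K i j = {k. 0 < x i j \<and> real k < tail_weight J (q i) (x i) (q i j)}" for i j
  define N where "N j = (SIGMA i:M. K i j)" for j
  have below: "{k. real k < g} = {..<nat \<lceil>g\<rceil>}" for g :: real
    by (auto simp: zless_nat_eq_int_zless less_ceiling_iff)
  have finK: "finite (K i j)" for i j
  proof -
    have "finite {k. real k < tail_weight J (q i) (x i) (q i j)}" by (simp add: below)
    then show ?thesis by (rule rev_finite_subset) (auto simp: K_def)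
  qed
  have slots: "(\<Sum>j\<in>S. x i j) \<le> real (card (\<Union>j\<in>S. K i j))" if S: "S \<subseteq> J" and i: "i \<in> M" for S i
  proof (cases "\<exists>j\<in>S. 0 < x i j")
    case True
    have finS: "finite S" using S assms(1) finite_subset by blast
    let ?P = "{j\<in>S. 0 < x i j}"
    have "finite ?P" "?P \<noteq> {}" using True finS by auto
    \<comment> \<open>A shortest job of \<open>S\<close> with positive fraction on \<open>i\<close>
      has the most slots there: its tail weight g covers the whole fraction of \<open>S\<close> on
      \<open>i\<close>, and the number of \<open>k\<close> with \<open>k < g\<close> is g rounded
      up.\<close>
    from arg_min_if_finite[OF this, of "q i"] obtain j where j: "j \<in> S" "0 < x i j" "\<And>j'. j' \<in> S \<Longrightarrow> 0 < x i j' \<Longrightarrow> q i j \<le> q i j'"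
      by (metis (mono_tags, lifting) mem_Collect_eq not_less)
    have "(\<Sum>j\<in>S. x i j) = (\<Sum>j\<in>?P. x i j)"
      using finS nonneg[OF i] S by (intro sum.mono_neutral_right) (auto simp: less_le)
    also have "\<dots> \<le> tail_weight J (q i) (x i) (q i j)"
      unfolding tail_weight_def using assms(1) S j(3) nonneg[OF i] by (intro sum_mono2) auto
    also have "\<dots> \<le> real (card (K i j))"
      using j(2) by (simp add: K_def below real_nat_ceiling_ge)
    also have "\<dots> \<le> real (card (\<Union>j\<in>S. K i j))"
      using finS finK j(1) by (intro of_nat_mono card_mono) auto
    finally show ?thesis .
  next
    case False
    then have "(\<Sum>j\<in>S. x i j) \<le> 0" by (intro sum_nonpos) (auto simp: not_less)
    then show ?thesis by linarith
  qed
  have "\<exists>f. inj_on f J \<and> (\<forall>j\<in>J. f j \<in> N j)"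
  proof (rule hall_marriage)
    show "finite J" by fact
    show "finite (N j)" for j unfolding N_def using assms(2) finK by auto
    fix S assume S: "S \<subseteq> J"
    have finS: "finite S" using S assms(1) finite_subset by blast
    have "real (card S) = (\<Sum>j\<in>S. \<Sum>i\<in>M. x i j)" using total S by (simp add: subset_iff)
    also have "\<dots> = (\<Sum>i\<in>M. \<Sum>j\<in>S. x i j)" by (rule sum.swap)
    also have "\<dots> \<le> (\<Sum>i\<in>M. real (card (\<Union>j\<in>S. K i j)))"
      using slots[OF S] by (rule sum_mono)
    also have "\<dots> = real (card (SIGMA i:M. \<Union>j\<in>S. K i j))"
      using assms(2) finS finK by simp
    also have "(SIGMA i:M. \<Union>j\<in>S. K i j) = \<Union>(N ` S)" by (auto simp: N_def)
    finally show "card S \<le> card (\<Union>(N ` S))" by simp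
  qed
  then obtain f where f: "inj_on f J" "\<And>j. j \<in> J \<Longrightarrow> f j \<in> N j" by blast
  show ?thesis
  proof (rule that[of "fst \<circ> f" "snd \<circ> f"])
    show "inj_on (\<lambda>j. ((fst \<circ> f) j, (snd \<circ> f) j)) J" using f(1) by simp
    fix j assume "j \<in> J"
    with f(2) have "f j \<in> N j" by blast
    then show "(fst \<circ> f) j \<in> M" "0 < x ((fst \<circ> f) j) j"
      "real ((snd \<circ> f) j)
        < tail_weight J (q ((fst \<circ> f) j)) (x ((fst \<circ> f) j)) (q ((fst \<circ> f) j) j)"
      by (auto simp: N_def K_def)
  qed
qed

section \<open>Load of a single machine\<close>

text \<open>
  Both sides are integrated over the thresholds \<open>s\<close>, writing \<open>q j\<close> as the number of \<open>s \<ge> 1\<close> with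
  \<open>s \<le> q j\<close>: at most \<open>tail_weight J q x s\<close> slots other than slot \<open>0\<close> hold a job of length at least \<open>s\<close>.
\<close>

lemma sum_slots_le_weighted_sum:
  fixes x :: "'j \<Rightarrow> real" and q :: "'j \<Rightarrow> nat"
  assumes "finite J" "A \<subseteq> J" "inj_on \<kappa> A"
    and nonneg: "\<And>j. j \<in> J \<Longrightarrow> 0 \<le> x j"
    and slot: "\<And>j. j \<in> A \<Longrightarrow> real (\<kappa> j) < tail_weight J q x (q j)"
  shows "(\<Sum>j\<in>{j\<in>A. \<kappa> j \<noteq> 0}. real (q j)) \<le> (\<Sum>j\<in>J. x j * real (q j))"
proof -
  let ?B = "{j\<in>A. \<kappa> j \<noteq> 0}"
  define Q where "Q = (\<Sum>j\<in>J. q j)"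
  have finB: "finite ?B" using assms(1,2) by (auto intro: finite_subset)
  have q: "real (q j) = (\<Sum>s\<in>{1..Q}. if s \<le> q j then 1 else 0)" if "j \<in> J" for j
  proof -
    have "q j \<le> Q" unfolding Q_def using that assms(1) by (intro member_le_sum) auto
    then have "{1..Q} \<inter> {s. s \<le> q j} = {1..q j}" by auto
    then show ?thesis by (simp add: sum.If_cases)
  qed
  have count: "real (card {j\<in>?B. s \<le> q j}) \<le> tail_weight J q x s" for s
  proof -
    let ?g = "tail_weight J q x s"
    have g0: "0 \<le> ?g" unfolding tail_weight_def using nonneg by (auto intro: sum_nonneg)
    \<comment> \<open>Leaving out slot 0 is what allows rounding \<open>?g\<close> down instead of
      up, so the count never exceeds the tail weight.\<close>
    have "\<kappa> ` {j\<in>?B. s \<le> q j} \<subseteq> {1..nat \<lfloor>?g\<rfloor>}"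
    proof safe
      fix j assume j: "j \<in> A" "s \<le> q j" "0 < \<kappa> j"
      have "tail_weight J q x (q j) \<le> ?g"
        unfolding tail_weight_def using j assms(1) nonneg by (intro sum_mono2) auto
      then have "real (\<kappa> j) \<le> ?g" using slot[OF j(1)] by linarith
      then show "\<kappa> j \<in> {1..nat \<lfloor>?g\<rfloor>}" using j(3) by (simp add: le_nat_floor Suc_le_eq)
    qed
    then have "card (\<kappa> ` {j\<in>?B. s \<le> q j}) \<le> nat \<lfloor>?g\<rfloor>"
      using card_mono[of "{1..nat \<lfloor>?g\<rfloor>}"] by fastforce
    moreover have "inj_on \<kappa> {j\<in>?B. s \<le> q j}" using assms(3) by (rule inj_on_subset) auto
    ultimately have "card {j\<in>?B. s \<le> q j} \<le> nat \<lfloor>?g\<rfloor>" by (simp add: card_image)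
    then show ?thesis using g0 by linarith
  qed
  have "(\<Sum>j\<in>?B. real (q j)) = (\<Sum>j\<in>?B. \<Sum>s\<in>{1..Q}. if s \<le> q j then 1 else 0)"
    using q assms(2) by (intro sum.cong) auto
  also have "\<dots> = (\<Sum>s\<in>{1..Q}. \<Sum>j\<in>?B. if s \<le> q j then 1 else 0)" by (rule sum.swap)
  also have "\<dots> = (\<Sum>s\<in>{1..Q}. real (card {j\<in>?B. s \<le> q j}))"
    using finB by (simp add: sum.If_cases Int_def)
  also have "\<dots> \<le> (\<Sum>s\<in>{1..Q}. tail_weight J q x s)" using count by (rule sum_mono)
  also have "\<dots> = (\<Sum>s\<in>{1..Q}. \<Sum>j\<in>J. x j * (if s \<le> q j then 1 else 0))"
    unfolding tail_weight_def sum.inter_filter[OF assms(1)] by (intro sum.cong refl) auto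
  also have "\<dots> = (\<Sum>j\<in>J. \<Sum>s\<in>{1..Q}. x j * (if s \<le> q j then 1 else 0))" by (rule sum.swap)
  also have "\<dots> = (\<Sum>j\<in>J. x j * real (q j))"
    using q by (simp add: sum_distrib_left)
  finally show ?thesis .
qed

lemma sum_slots_le:
  fixes q :: "'j \<Rightarrow> nat" and \<gamma> :: real
  assumes "finite A" "inj_on \<kappa> A" "0 < \<gamma>"
    and range: "\<And>j. j \<in> A \<Longrightarrow> \<gamma> \<le> real (q j) \<and> real (q j) \<le> 3 * \<gamma>"
    and harmonic: "\<And>j. j \<in> A \<Longrightarrow> (\<kappa> j + 1) * q j \<le> T"
    and tail: "(\<Sum>j\<in>{j\<in>A. \<kappa> j \<noteq> 0}. real (q j)) \<le> real T"
  shows "(\<Sum>j\<in>A. real (q j)) \<le> 11 / 6 * real T"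
proof (cases "real T < 4 * \<gamma>")
  case True
  have h: "(real (\<kappa> j) + 1) * real (q j) \<le> real T" if "j \<in> A" for j
    using of_nat_mono[OF harmonic[OF that], where 'a = real] by (simp add: algebra_simps)
  \<comment> \<open>A job in slot 3 or beyond would give
    \<open>4 * \<gamma> \<le> T\<close>.\<close>
  have "\<kappa> j < 3" if "j \<in> A" for j
  proof -
    have "(real (\<kappa> j) + 1) * \<gamma> \<le> (real (\<kappa> j) + 1) * real (q j)"
      using range[OF that] by (intro mult_left_mono) auto
    also have "\<dots> < 4 * \<gamma>" using h[OF that] True by linarith
    finally show ?thesis using assms(3) by simp
  qed
  then have sub: "\<kappa> ` A \<subseteq> {..<3}" by auto
  have "(\<Sum>j\<in>A. real (q j)) \<le> (\<Sum>j\<in>A. real T / (real (\<kappa> j) + 1))"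
    using h by (intro sum_mono) (simp add: field_simps)
  also have "\<dots> = (\<Sum>k\<in>\<kappa> ` A. real T / (real k + 1))"
    using assms(2) by (simp add: sum.reindex)
  also have "\<dots> \<le> (\<Sum>k<3. real T / (real k + 1))"
    using sub by (intro sum_mono2) auto
  \<comment> \<open>The constant of the theorem arises here, as 1 + 1/2 + 1/3.\<close>
  also have "\<dots> = 11 / 6 * real T" by (simp add: eval_nat_numeral)
  finally show ?thesis .
next
  case False
  let ?Z = "{j\<in>A. \<kappa> j = 0}"
  have "card ?Z \<le> 1"
    using assms(1,2) by (auto simp: card_le_Suc0_iff_eq inj_on_def)
  have "(\<Sum>j\<in>?Z. real (q j)) \<le> real (card ?Z) * (3 * \<gamma>)"
    using range by (intro sum_bounded_above) auto
  also have "\<dots> \<le> 1 * (3 * \<gamma>)"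
    using \<open>card ?Z \<le> 1\<close> assms(3) by (intro mult_right_mono) auto
  finally have Z: "(\<Sum>j\<in>?Z. real (q j)) \<le> 3 * \<gamma>" by simp
  have "(\<Sum>j\<in>A. real (q j)) = (\<Sum>j\<in>?Z. real (q j)) + (\<Sum>j\<in>{j\<in>A. \<kappa> j \<noteq> 0}. real (q j))"
    using assms(1) by (subst sum.union_disjoint[symmetric]) (auto intro: sum.cong)
  \<comment> \<open>The bound obtained is 7/4 of \<open>T\<close>, which is below 11/6 of
    \<open>T\<close>.\<close>
  then show ?thesis using Z tail False by simp
qed

section \<open>From configurations to fractions\<close>

definition assigned_fraction ::
    "'j set \<Rightarrow> ('m \<Rightarrow> 'j \<Rightarrow> enat) \<Rightarrow> nat \<Rightarrow> ('m \<Rightarrow> 'j set \<Rightarrow> real) \<Rightarrow> 'm \<Rightarrow> 'j \<Rightarrow> real" where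
  "assigned_fraction J p T y i j = (\<Sum>C\<in>{C\<in>configurations J p T i. j \<in> C}. y i C)"

lemma finite_configurations: "finite J \<Longrightarrow> finite (configurations J p T i)"
  unfolding configurations_def by (rule finite_subset[of _ "Pow J"]) auto

lemma sum_the_enat:
  assumes "finite C" "(\<Sum>j\<in>C. f j) \<noteq> (\<infinity> :: enat)"
  shows "(\<Sum>j\<in>C. f j) = enat (\<Sum>j\<in>C. the_enat (f j))"
  using assms
proof (induction C rule: finite_induct)
  case (insert a C)
  then have "f a \<noteq> \<infinity>" "(\<Sum>j\<in>C. f j) \<noteq> \<infinity>"
    by (metis plus_eq_infty_iff_enat sum.insert)+
  then show ?case using insert.hyps insert.IH by auto
qed (simp add: zero_enat_def)

text \<open>Justifies computing with \<open>the_enat\<close>, which is unspecified at infinity: a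
  finite target keeps infinite processing times out of every configuration.\<close>

lemma configuration_finite:
  assumes "finite J" "C \<in> configurations J p T i"
  shows "(\<Sum>j\<in>C. the_enat (p i j)) \<le> T" and "\<And>j. j \<in> C \<Longrightarrow> p i j \<noteq> \<infinity>"
proof -
  have fin: "finite C" using assms by (auto simp: configurations_def intro: finite_subset)
  have C: "(\<Sum>j\<in>C. p i j) \<le> enat T" using assms(2) by (simp add: configurations_def)
  then have "(\<Sum>j\<in>C. p i j) \<noteq> \<infinity>" by (intro notI) simp
  from sum_the_enat[OF fin this] show "(\<Sum>j\<in>C. the_enat (p i j)) \<le> T" using C by simp
  fix j assume "j \<in> C"
  then have "p i j \<le> (\<Sum>j\<in>C. p i j)" using fin by (intro member_le_sum) auto
  also note C
  finally show "p i j \<noteq> \<infinity>" by (intro notI) simp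
qed

text \<open>Double counting of pairs of a job and a configuration containing it. It is used with
  lengths as \<open>w\<close> to bound the fractional load, and with the constant 1 to express the
  tail weight by configurations.\<close>

lemma sum_assigned_fraction:
  assumes "finite J" "D \<subseteq> J"
  shows "(\<Sum>j\<in>D. assigned_fraction J p T y i j * w j) =
    (\<Sum>C\<in>configurations J p T i. y i C * (\<Sum>j\<in>C \<inter> D. w j))"
proof -
  let ?Q = "configurations J p T i"
  have fin: "finite ?Q" "finite D"
    using assms by (auto intro: finite_configurations finite_subset)
  have "(\<Sum>j\<in>D. assigned_fraction J p T y i j * w j) =
      (\<Sum>j\<in>D. \<Sum>C\<in>{C. C \<in> ?Q \<and> j \<in> C}. y i C * w j)"
    by (simp add: assigned_fraction_def sum_distrib_right)
  also have "\<dots> = (\<Sum>C\<in>?Q. \<Sum>j\<in>{j. j \<in> D \<and> j \<in> C}. y i C * w j)"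
    using fin by (intro sum.swap_restrict) auto
  also have "\<dots> = (\<Sum>C\<in>?Q. y i C * (\<Sum>j\<in>C \<inter> D. w j))"
    by (intro sum.cong refl) (simp add: sum_distrib_left Int_def conj_commute)
  finally show ?thesis .
qed

context
  fixes J :: "'j set" and M :: "'m set" and p :: "'m \<Rightarrow> 'j \<Rightarrow> enat" and T :: nat
    and y :: "'m \<Rightarrow> 'j set \<Rightarrow> real"
  assumes finJ: "finite J" and sol: "conf_LP_solution J M p T y"
begin

text \<open>For a machine \<open>i\<close>, the values \<open>y i C\<close> form a probability
  distribution on configurations. Read contrapositively, a mean above \<open>b\<close> yields a
  configuration with value above \<open>b\<close>.\<close>

lemma conf_LP_average_le:
  assumes "i \<in> M" "\<And>C. C \<in> configurations J p T i \<Longrightarrow> f C \<le> b"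
  shows "(\<Sum>C\<in>configurations J p T i. y i C * f C) \<le> b"
proof -
  have "(\<Sum>C\<in>configurations J p T i. y i C * f C) \<le> (\<Sum>C\<in>configurations J p T i. y i C * b)"
    using sol assms by (intro sum_mono mult_left_mono) (auto simp: conf_LP_solution_def)
  also have "\<dots> = b"
    using sol assms(1) by (simp add: conf_LP_solution_def flip: sum_distrib_right)
  finally show ?thesis .
qed

lemma assigned_fraction_nonneg: "i \<in> M \<Longrightarrow> 0 \<le> assigned_fraction J p T y i j"
  using sol by (auto simp: conf_LP_solution_def assigned_fraction_def intro!: sum_nonneg)

lemma sum_fraction_times_length_le:
  assumes "i \<in> M"
  shows "(\<Sum>j\<in>J. assigned_fraction J p T y i j * real (the_enat (p i j))) \<le> real T"
  unfolding sum_assigned_fraction[OF finJ order_refl]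
proof (rule conf_LP_average_le[OF assms])
  fix C assume C: "C \<in> configurations J p T i"
  then have "C \<inter> J = C" by (auto simp: configurations_def)
  then show "(\<Sum>j\<in>C \<inter> J. real (the_enat (p i j))) \<le> real T"
    using of_nat_mono[OF configuration_finite(1)[OF finJ C], where 'a = real] by simp
qed

lemma slot_times_length_le:
  assumes i: "i \<in> M"
    and k: "real k < tail_weight J (\<lambda>j. the_enat (p i j)) (assigned_fraction J p T y i) s"
  shows "(k + 1) * s \<le> T"
proof -
  \<comment> \<open>Jobs of infinite processing time may end up in \<open>?D\<close>, but none of
    them survives the intersection with a configuration.\<close>
  let ?D = "{j\<in>J. s \<le> the_enat (p i j)}"
  have "tail_weight J (\<lambda>j. the_enat (p i j)) (assigned_fraction J p T y i) s =
      (\<Sum>C\<in>configurations J p T i. y i C * real (card (C \<inter> ?D)))"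
    using sum_assigned_fraction[OF finJ, of ?D p T y i "\<lambda>_. 1"] by (simp add: tail_weight_def)
  \<comment> \<open>The tail weight is the mean number of jobs of \<open>?D\<close> in a random
    configuration. As it exceeds \<open>k\<close>, some configuration has more than \<open>k\<close>
    of them, hence at least \<open>k + 1\<close> by integrality.\<close>
  then have "\<not> (\<forall>C\<in>configurations J p T i. real (card (C \<inter> ?D)) \<le> real k)"
    using conf_LP_average_le[OF i, of "\<lambda>C. real (card (C \<inter> ?D))" "real k"] k by auto
  then obtain C where C: "C \<in> configurations J p T i" "k + 1 \<le> card (C \<inter> ?D)"
    by auto
  have "finite C" using C(1) finJ by (auto simp: configurations_def intro: finite_subset)
  have "(k + 1) * s \<le> card (C \<inter> ?D) * s" using C(2) by (rule mult_le_mono1)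
  also have "\<dots> \<le> (\<Sum>j\<in>C \<inter> ?D. the_enat (p i j))"
    using sum_bounded_below[of "C \<inter> ?D" s "\<lambda>j. the_enat (p i j)"] by auto
  also have "\<dots> \<le> (\<Sum>j\<in>C. the_enat (p i j))" using \<open>finite C\<close> by (intro sum_mono2) auto
  also have "\<dots> \<le> T" by (rule configuration_finite(1)[OF finJ C(1)])
  finally show ?thesis .
qed

lemma assigned_fraction_pos_imp_finite:
  assumes "0 < assigned_fraction J p T y i j"
  shows "p i j \<noteq> \<infinity>"
proof -
  have "{C\<in>configurations J p T i. j \<in> C} \<noteq> {}"
    using assms unfolding assigned_fraction_def by (metis less_irrefl sum.empty)
  then obtain C where "C \<in> configurations J p T i" "j \<in> C" by blast
  then show ?thesis by (rule configuration_finite(2)[OF finJ])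
qed

end

section \<open>Existence of a feasible target\<close>

text \<open>A schedule with finite processing times is an integral LP solution. Existence is what
  makes the \<open>LEAST\<close> in \<open>conf_LP_value\<close> itself a feasible target.\<close>

lemma (in unrelated_instance) conf_LP_feasible_exists: "\<exists>T. conf_LP_feasible J M p T"
proof -
  obtain \<sigma> where \<sigma>: "\<And>j. j \<in> J \<Longrightarrow> \<sigma> j \<in> M" "\<And>j. j \<in> J \<Longrightarrow> p (\<sigma> j) j < \<infinity>"
    using processing_finite by metis
  let ?A = "\<lambda>i. {j\<in>J. \<sigma> j = i}"
  \<comment> \<open>The sum of all loads is a crude target, but it bounds each load.\<close>
  define T where "T = (\<Sum>i\<in>M. \<Sum>j\<in>?A i. the_enat (p i j))"
  define y :: "'m \<Rightarrow> 'j set \<Rightarrow> real" where "y i C = (if C = ?A i then 1 else 0)" for i C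
  have conf: "?A i \<in> configurations J p T i" if "i \<in> M" for i
  proof -
    have "(\<Sum>j\<in>?A i. p i j) = (\<Sum>j\<in>?A i. enat (the_enat (p i j)))"
      using \<sigma>(2) by (intro sum.cong refl) force
    also have "\<dots> = enat (\<Sum>j\<in>?A i. the_enat (p i j))" by (simp flip: of_nat_eq_enat)
    also have "\<dots> \<le> enat T"
      unfolding T_def using that finite_machines
      by (simp add: member_le_sum[of i M "\<lambda>i. \<Sum>j\<in>?A i. the_enat (p i j)"])
    finally show ?thesis by (simp add: configurations_def)
  qed
  have "conf_LP_solution J M p T y"
    unfolding conf_LP_solution_def
  proof (intro conjI ballI)
    show "0 \<le> y i C" for i C by (simp add: y_def)
    show "(\<Sum>C\<in>configurations J p T i. y i C) = 1" if "i \<in> M" for i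
      using conf[OF that] finite_jobs by (simp add: y_def finite_configurations)
    fix j assume j: "j \<in> J"
    have "(\<Sum>C\<in>{C\<in>configurations J p T i. j \<in> C}. y i C) = (if i = \<sigma> j then 1 else 0)"
      if "i \<in> M" for i
      using conf[OF that] finite_jobs j by (auto simp: y_def finite_configurations)
    then have "(\<Sum>i\<in>M. \<Sum>C\<in>{C\<in>configurations J p T i. j \<in> C}. y i C) =
        (\<Sum>i\<in>M. if i = \<sigma> j then 1 else 0)" by (intro sum.cong) auto
    then show "(\<Sum>i\<in>M. \<Sum>C\<in>{C\<in>configurations J p T i. j \<in> C}. y i C) = 1"
      using \<sigma>(1)[OF j] finite_machines by simp
  qed
  then show ?thesis unfolding conf_LP_feasible_def by blast
qed

section \<open>Rounding at the least feasible target\<close>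

theorem theorem8:
  fixes J :: "'j set" and M :: "'m set" and p :: "'m \<Rightarrow> 'j \<Rightarrow> enat" and \<gamma> :: real
  assumes "unrelated_instance J M p"
    and "0 < \<gamma>"
    and "\<And>i j. i \<in> M \<Longrightarrow> j \<in> J \<Longrightarrow> ereal_of_enat (p i j) \<in> {ereal \<gamma>..ereal (3 * \<gamma>)} \<union> {\<infinity>}"
  shows "ereal_of_enat (min_makespan J M p) \<le> ereal ((1 + 5 / 6) * real (conf_LP_value J M p))"
proof -
  interpret unrelated_instance J M p by fact
  define T where "T = conf_LP_value J M p"
  have "conf_LP_feasible J M p T"
    unfolding T_def conf_LP_value_def using conf_LP_feasible_exists by (rule LeastI_ex)
  then obtain y where y: "conf_LP_solution J M p T y" unfolding conf_LP_feasible_def by blast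
  define x where "x = assigned_fraction J p T y"
  define q where "q = (\<lambda>i j. the_enat (p i j))"
  have x0: "0 \<le> x i j" if "i \<in> M" for i j
    unfolding x_def using finite_jobs y that by (rule assigned_fraction_nonneg)
  have x1: "(\<Sum>i\<in>M. x i j) = 1" if "j \<in> J" for j
    using y that by (simp add: x_def assigned_fraction_def conf_LP_solution_def)
  obtain \<sigma> \<kappa> where inj: "inj_on (\<lambda>j. (\<sigma> j, \<kappa> j)) J"
    and \<sigma>: "\<And>j. j \<in> J \<Longrightarrow> \<sigma> j \<in> M" "\<And>j. j \<in> J \<Longrightarrow> 0 < x (\<sigma> j) j"
    and \<kappa>: "\<And>j. j \<in> J \<Longrightarrow> real (\<kappa> j) < tail_weight J (q (\<sigma> j)) (x (\<sigma> j)) (q (\<sigma> j) j)"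
  proof (rule slot_matching[OF finite_jobs finite_machines, of x q])
    show "0 \<le> x i j" if "i \<in> M" for i j using that by (rule x0)
    show "(\<Sum>i\<in>M. x i j) = 1" if "j \<in> J" for j using that by (rule x1)
  qed (rule that)
  \<comment> \<open>The matching uses only positive fractions, so every processing time in use is
    finite and the interval hypothesis applies to it.\<close>
  have p: "p (\<sigma> j) j = enat (q (\<sigma> j) j)" if "j \<in> J" for j
    using assigned_fraction_pos_imp_finite[OF finite_jobs y, where i = "\<sigma> j" and j = j] \<sigma>(2)[OF that]
    by (auto simp: x_def q_def)
  have load: "ereal_of_enat (machine_load J p \<sigma> i) \<le> ereal (11 / 6 * real T)" if i: "i \<in> M" for i
  proof -
    let ?A = "{j\<in>J. \<sigma> j = i}"
    have injA: "inj_on \<kappa> ?A" using inj by (auto simp: inj_on_def)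
    have "(\<Sum>j\<in>?A. real (q i j)) \<le> 11 / 6 * real T"
    proof (rule sum_slots_le[OF _ injA assms(2)])
      show "finite ?A" using finite_jobs by simp
      show "\<gamma> \<le> real (q i j) \<and> real (q i j) \<le> 3 * \<gamma>" if "j \<in> ?A" for j
        using assms(3)[of i j] p[of j] that i by auto
      show "(\<kappa> j + 1) * q i j \<le> T" if "j \<in> ?A" for j
        using slot_times_length_le[OF finite_jobs y i, of "\<kappa> j" "q i j"] \<kappa>[of j] that
        by (auto simp: x_def q_def)
      have "(\<Sum>j\<in>{j\<in>?A. \<kappa> j \<noteq> 0}. real (q i j)) \<le> (\<Sum>j\<in>J. x i j * real (q i j))"
        using finite_jobs injA x0[OF i] \<kappa> by (intro sum_slots_le_weighted_sum) auto
      also have "\<dots> \<le> real T"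
        unfolding x_def q_def using sum_fraction_times_length_le[OF finite_jobs y i] .
      finally show "(\<Sum>j\<in>{j\<in>?A. \<kappa> j \<noteq> 0}. real (q i j)) \<le> real T" .
    qed
    moreover have "machine_load J p \<sigma> i = enat (\<Sum>j\<in>?A. q i j)"
    proof -
      have "machine_load J p \<sigma> i = (\<Sum>j\<in>?A. enat (q i j))"
        unfolding machine_load_def using p by (intro sum.cong) auto
      then show ?thesis by (simp flip: of_nat_eq_enat)
    qed
    ultimately show ?thesis by simp
  qed
  \<comment> \<open>Schedules are extensional, while \<open>\<sigma>\<close> is arbitrary outside
    \<open>J\<close>; the loads only see jobs of \<open>J\<close>.\<close>
  let ?\<sigma> = "restrict \<sigma> J"
  have "?\<sigma> \<in> schedules J M" using \<sigma>(1) by (auto simp: schedules_def)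
  moreover have "finite (schedules J M)"
    unfolding schedules_def using finite_jobs finite_machines by (simp add: finite_PiE)
  ultimately have "min_makespan J M p \<le> makespan J M p ?\<sigma>"
    unfolding min_makespan_def by simp
  moreover have "makespan J M p ?\<sigma> \<in> machine_load J p ?\<sigma> ` M"
    unfolding makespan_def using finite_machines machines_nonempty by (intro Max_in) auto
  then obtain i where i: "i \<in> M" "makespan J M p ?\<sigma> = machine_load J p ?\<sigma> i" by blast
  moreover have "machine_load J p ?\<sigma> i = machine_load J p \<sigma> i"
    unfolding machine_load_def by (intro sum.cong) auto
  ultimately have "ereal_of_enat (min_makespan J M p) \<le> ereal_of_enat (machine_load J p \<sigma> i)"
    by simp
  also have "\<dots> \<le> ereal (11 / 6 * real T)" using load[OF i(1)] .
  finally show ?thesis by (simp add: T_def)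
qed

end
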